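(* Let $H$ be a nonempty graph of order $n'$ and let $G$ be a graph of order $n$. Then $$\gamma_{\rm sp}(G\circ H)\le \alpha(G)\,\gamma_{\rm sp}(H)+(n-\alpha(G))\,n'.$$ In particular, if $\gamma_{\rm sp}(H)=n'-1$ and $H\not\cong K_{n'}$, then $$\gamma_{\rm sp}(G\circ H)\le nn'-\alpha_2(G).$$
   Context: All graphs are finite, simple and undirected, with nonempty vertex set; the order of a graph is its number of vertices. An empty graph is a graph without edges, and a nonempty graph is one with at least one edge. $K_m$ is the complete graph of order $m$. For a vertex $v$ of $G$, $N(v)$ is the set of vertices adjacent to $v$, and for $D\subseteq V(G)$, $\overline{D}=V(G)\setminus D$. A set $D\subseteq V(G)$ is a super dominating set of $G$ if for every $u\in\overline{D}$ there exists $v\in D$ such that $N(v)\cap\overline{D}=\{u\}$. The super domination number $\gamma_{\rm sp}(G)$ is the minimum cardinality of a super dominating set of $G$. The lexicographic product $G\circ H$ has vertex set $V(G)\times V(H)$, and $(g,h)$ is adjacent to $(g',h')$ if and only if $gg'\in E(G)$, or $g=g'$ and $hh'\in E(H)$. $\alpha(G)$ is the independence number of $G$. A $k$-independent set of $G$ is a set $S\subseteq V(G)$ with $|N(x)\cap S|\le k-1$ for every $x\in S$, and $\alpha_k(G)$ is the maximum cardinality of a $k$-independent set of $G$; in particular $\alpha_2(G)$ is the maximum size of a set inducing a subgraph of maximum degree at most $1$. *)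

theory Defs
  imports "Graph_Theory.Graph_Theory"
begin

text \<open>
  A finite simple undirected graph is a \<^locale>\<open>pair_graph\<close>: finite vertex set, no loops, and a
  symmetric set of ordered pairs, each edge being present in both orientations. Graph_Theory also
  admits the graph without vertices, so nonemptiness of the vertex set has to be assumed.
\<close>

definition neighborhood :: "'a pair_pre_digraph \<Rightarrow> 'a \<Rightarrow> 'a set" where
  "neighborhood G v = {w \<in> pverts G. (v, w) \<in> parcs G}"

definition super_dominating_set :: "'a pair_pre_digraph \<Rightarrow> 'a set \<Rightarrow> bool" where
  "super_dominating_set G D \<longleftrightarrow>
     D \<subseteq> pverts G \<and>
     (\<forall>u \<in> pverts G - D. \<exists>v \<in> D. neighborhood G v \<inter> (pverts G - D) = {u})"

definition super_domination_number :: "'a pair_pre_digraph \<Rightarrow> nat" where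
  "super_domination_number G = Min (card ` {D. super_dominating_set G D})"

definition lexicographic_product ::
  "'a pair_pre_digraph \<Rightarrow> 'b pair_pre_digraph \<Rightarrow> ('a \<times> 'b) pair_pre_digraph" where
  "lexicographic_product G H =
     \<lparr> pverts = pverts G \<times> pverts H,
       parcs = {((g, h), (g', h')) | g h g' h'.
         g \<in> pverts G \<and> h \<in> pverts H \<and> g' \<in> pverts G \<and> h' \<in> pverts H \<and>
         ((g, g') \<in> parcs G \<or> g = g' \<and> (h, h') \<in> parcs H)} \<rparr>"

definition independent_set :: "'a pair_pre_digraph \<Rightarrow> 'a set \<Rightarrow> bool" where
  "independent_set G S \<longleftrightarrow>
     S \<subseteq> pverts G \<and> (\<forall>x \<in> S. \<forall>y \<in> S. (x, y) \<notin> parcs G)"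

definition independence_number :: "'a pair_pre_digraph \<Rightarrow> nat" where
  "independence_number G = Max (card ` {S. independent_set G S})"

text \<open>The bound is \<open>k - 1\<close>; the strict form avoids truncated subtraction.\<close>

definition k_independent_set :: "nat \<Rightarrow> 'a pair_pre_digraph \<Rightarrow> 'a set \<Rightarrow> bool" where
  "k_independent_set k G S \<longleftrightarrow>
     S \<subseteq> pverts G \<and> (\<forall>x \<in> S. card (neighborhood G x \<inter> S) < k)"

definition k_independence_number :: "nat \<Rightarrow> 'a pair_pre_digraph \<Rightarrow> nat" where
  "k_independence_number k G = Max (card ` {S. k_independent_set k G S})"

text \<open>
  On a finite graph the sets under \<^const>\<open>Min\<close> and \<^const>\<open>Max\<close> above are finite and nonempty.
\<close>

lemma card_super_dominating_sets:
  assumes "finite (pverts G)"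
  shows "finite (card ` {D. super_dominating_set G D})"
    and "card ` {D. super_dominating_set G D} \<noteq> {}"
proof -
  have "{D. super_dominating_set G D} \<subseteq> Pow (pverts G)"
    by (auto simp: super_dominating_set_def)
  then show "finite (card ` {D. super_dominating_set G D})"
    using assms by (meson finite_Pow_iff finite_imageI finite_subset)
  have "super_dominating_set G (pverts G)"
    by (simp add: super_dominating_set_def)
  then show "card ` {D. super_dominating_set G D} \<noteq> {}"
    by blast
qed

lemma card_independent_sets:
  assumes "finite (pverts G)"
  shows "finite (card ` {S. independent_set G S})"
    and "card ` {S. independent_set G S} \<noteq> {}"
proof -
  have "{S. independent_set G S} \<subseteq> Pow (pverts G)"
    by (auto simp: independent_set_def)
  then show "finite (card ` {S. independent_set G S})"
    using assms by (meson finite_Pow_iff finite_imageI finite_subset)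
  have "independent_set G {}"
    by (simp add: independent_set_def)
  then show "card ` {S. independent_set G S} \<noteq> {}"
    by blast
qed

lemma card_k_independent_sets:
  assumes "finite (pverts G)"
  shows "finite (card ` {S. k_independent_set k G S})"
    and "card ` {S. k_independent_set k G S} \<noteq> {}"
proof -
  have "{S. k_independent_set k G S} \<subseteq> Pow (pverts G)"
    by (auto simp: k_independent_set_def)
  then show "finite (card ` {S. k_independent_set k G S})"
    using assms by (meson finite_Pow_iff finite_imageI finite_subset)
  have "k_independent_set k G {}"
    by (simp add: k_independent_set_def)
  then show "card ` {S. k_independent_set k G S} \<noteq> {}"
    by blast
qed

lemma pair_graph_lexicographic_product:
  assumes "pair_graph G" "pair_graph H"
  shows "pair_graph (lexicographic_product G H)"
proof -
  interpret G: pair_graph G by fact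
  interpret H: pair_graph H by fact
  let ?P = "lexicographic_product G H"
  have fin: "finite (pverts ?P)"
    using G.pair_finite_verts H.pair_finite_verts by (simp add: lexicographic_product_def)
  have sub: "parcs ?P \<subseteq> pverts ?P \<times> pverts ?P"
    by (auto simp: lexicographic_product_def)
  have "sym (parcs ?P)"
    by (rule symI)
      (auto simp: lexicographic_product_def dest: G.arcs_symmetric H.arcs_symmetric)
  then have sym: "symmetric (with_proj ?P)"
    by (simp add: symmetric_def)
  have loops: "fst e \<noteq> snd e" if "e \<in> parcs ?P" for e
    using that G.no_loops' H.no_loops' by (fastforce simp: lexicographic_product_def)
  show ?thesis
    using fin sub sym loops finite_subset[OF sub]
    by unfold_locales auto
qed

end

theory Submission
  imports Defs
begin

text \<open>
  Both bounds come from exhibiting a large set \<open>C\<close> of vertices of \<open>G \<circ> H\<close> that can be left out of a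
  super dominating set, i.e. in which every vertex is the only neighbour in \<open>C\<close> of some vertex
  outside \<open>C\<close> (\<open>super_domination_number_le\<close>). A vertex \<open>(g, x)\<close> sees \<open>C\<close> in two ways: it sees all of
  \<open>C\<close> in the fibres over the neighbours of \<open>g\<close>, and it sees its own fibre as \<open>x\<close> does in \<open>H\<close>.

  For the first bound, \<open>C = S \<times> W\<close> with \<open>S\<close> a maximum independent set of \<open>G\<close> and \<open>W\<close> the complement
  of a minimum super dominating set of \<open>H\<close>: fibres over \<open>S\<close> do not see each other, so the private
  neighbours in \<open>H\<close> serve in each fibre separately.

  For the second bound, \<open>C = S \<times> {a}\<close> with \<open>S\<close> a maximum 2-independent set of \<open>G\<close> and \<open>a\<close> a vertex
  of \<open>H\<close> that has both a neighbour \<open>d\<close> and a nonneighbour \<open>b \<noteq> a\<close>. The graph induced on \<open>S\<close> consists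
  of isolated vertices and isolated edges. If \<open>g\<close> is isolated in it, then \<open>(g, d)\<close> sees only \<open>(g, a)\<close>
  in \<open>C\<close>. If \<open>g g'\<close> is an edge of it, then \<open>(g', b)\<close> sees \<open>(g, a)\<close> but, as \<open>a\<close> and \<open>b\<close> are
  nonadjacent, not \<open>(g', a)\<close>.
\<close>

lemma super_domination_number_le:
  assumes "finite (pverts G)" and "C \<subseteq> pverts G"
    and "\<And>u. u \<in> C \<Longrightarrow> \<exists>v \<in> pverts G - C. neighborhood G v \<inter> C = {u}"
  shows "int (super_domination_number G) \<le> int (card (pverts G)) - int (card C)"
proof -
  have "pverts G - (pverts G - C) = C" using assms(2) by blast
  then have "super_dominating_set G (pverts G - C)"
    using assms(3) by (simp add: super_dominating_set_def)
  then have "super_domination_number G \<le> card (pverts G - C)"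
    unfolding super_domination_number_def
    by (intro Min_le card_super_dominating_sets(1) assms(1)) blast
  also have "int (card (pverts G - C)) = int (card (pverts G)) - int (card C)"
    using assms(1,2) by (simp add: card_Diff_subset card_mono finite_subset of_nat_diff)
  finally show ?thesis by simp
qed

lemma obtain_minimum_super_dominating_set:
  assumes "finite (pverts G)"
  obtains D where "super_dominating_set G D" "card D = super_domination_number G"
  using Min_in[OF card_super_dominating_sets[OF assms]]
  by (auto simp: super_domination_number_def)

lemma obtain_maximum_independent_set:
  assumes "finite (pverts G)"
  obtains S where "independent_set G S" "card S = independence_number G"
  using Max_in[OF card_independent_sets[OF assms]]
  by (auto simp: independence_number_def)

lemma obtain_maximum_k_independent_set:
  assumes "finite (pverts G)"
  obtains S where "k_independent_set k G S" "card S = k_independence_number k G"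
  using Max_in[OF card_k_independent_sets[OF assms, where k = k]]
  by (auto simp: k_independence_number_def)

lemma pverts_lexicographic_product [simp]:
  "pverts (lexicographic_product G H) = pverts G \<times> pverts H"
  by (simp add: lexicographic_product_def)

lemma mem_neighborhood_lexicographic_product:
  assumes "g \<in> pverts G" "h \<in> pverts H"
  shows "(g', h') \<in> neighborhood (lexicographic_product G H) (g, h) \<longleftrightarrow>
           g' \<in> neighborhood G g \<and> h' \<in> pverts H \<or> g' = g \<and> h' \<in> neighborhood H h"
  using assms by (auto simp: neighborhood_def lexicographic_product_def)

lemma super_domination_number_lexicographic_product_le_independence:
  assumes "finite (pverts G)" and "finite (pverts H)"
  shows "int (super_domination_number (lexicographic_product G H))
           \<le> int (independence_number G) * int (super_domination_number H)
              + (int (card (pverts G)) - int (independence_number G)) * int (card (pverts H))"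
proof -
  obtain S where S: "independent_set G S" "card S = independence_number G"
    using obtain_maximum_independent_set[OF assms(1)] .
  obtain D where D: "super_dominating_set H D" "card D = super_domination_number H"
    using obtain_minimum_super_dominating_set[OF assms(2)] .
  define W where "W = pverts H - D"
  have SG: "S \<subseteq> pverts G" and DH: "D \<subseteq> pverts H"
    using S(1) D(1) by (auto simp: independent_set_def super_dominating_set_def)
  have WH: "W \<subseteq> pverts H" by (auto simp: W_def)
  have "int (super_domination_number (lexicographic_product G H))
          \<le> int (card (pverts (lexicographic_product G H))) - int (card (S \<times> W))"
  proof (rule super_domination_number_le)
    fix u assume "u \<in> S \<times> W"
    then obtain g h where u: "u = (g, h)" and g: "g \<in> S" and h: "h \<in> W" by blast
    obtain v where v: "v \<in> D" "neighborhood H v \<inter> W = {h}"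
      using D(1) h unfolding super_dominating_set_def W_def by blast
    have gG: "g \<in> pverts G" and vH: "v \<in> pverts H" using g v(1) SG DH by auto
    have indep: "neighborhood G g \<inter> S = {}"
      using S(1) g by (auto simp: independent_set_def neighborhood_def)
    have "p \<in> neighborhood (lexicographic_product G H) (g, v) \<inter> S \<times> W \<longleftrightarrow> p = (g, h)" for p
      using indep v(2) g
      by (cases p) (auto simp: mem_neighborhood_lexicographic_product[OF gG vH])
    moreover have "(g, v) \<in> pverts (lexicographic_product G H) - S \<times> W"
      using gG vH v(1) by (simp add: W_def)
    ultimately show "\<exists>v \<in> pverts (lexicographic_product G H) - S \<times> W.
        neighborhood (lexicographic_product G H) v \<inter> S \<times> W = {u}"
      unfolding u by blast
  qed (use assms SG WH in auto)
  moreover have "int (card W) = int (card (pverts H)) - int (card D)"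
    using assms(2) DH
    by (simp add: W_def card_Diff_subset card_mono finite_subset of_nat_diff)
  ultimately show ?thesis
    by (simp add: card_cartesian_product S(2) D(2) algebra_simps)
qed

lemma super_domination_number_lexicographic_product_le_2_independence:
  assumes "pair_graph G" and "finite (pverts H)"
    and "a \<in> pverts H" "b \<in> pverts H" "a \<noteq> b" "(b, a) \<notin> parcs H"
    and "d \<in> pverts H" "a \<noteq> d" "(d, a) \<in> parcs H"
  shows "int (super_domination_number (lexicographic_product G H))
           \<le> int (card (pverts G)) * int (card (pverts H)) - int (k_independence_number 2 G)"
proof -
  interpret G: pair_graph G by fact
  obtain S where S: "k_independent_set 2 G S" "card S = k_independence_number 2 G"
    using obtain_maximum_k_independent_set[OF G.pair_finite_verts] .
  have SG: "S \<subseteq> pverts G" using S(1) by (simp add: k_independent_set_def)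
  then have finS: "finite S" using G.pair_finite_verts by (rule finite_subset)
  have at_most_one: "neighborhood G x \<inter> S = {y}" if "x \<in> S" "y \<in> neighborhood G x" "y \<in> S" for x y
  proof -
    have "card (neighborhood G x \<inter> S) \<le> Suc 0"
      using S(1) that(1) by (auto simp: k_independent_set_def less_Suc_eq_le numeral_2_eq_2)
    moreover have "finite (neighborhood G x \<inter> S)" using finS by simp
    ultimately show ?thesis
      using that(2,3) card_le_Suc0_iff_eq by blast
  qed
  have "int (super_domination_number (lexicographic_product G H))
          \<le> int (card (pverts (lexicographic_product G H))) - int (card (S \<times> {a}))"
  proof (rule super_domination_number_le)
    fix u assume "u \<in> S \<times> {a}"
    then obtain g where u: "u = (g, a)" and g: "g \<in> S" by blast
    then have gG: "g \<in> pverts G" using SG by blast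
    show "\<exists>v \<in> pverts (lexicographic_product G H) - S \<times> {a}.
        neighborhood (lexicographic_product G H) v \<inter> S \<times> {a} = {u}"
    proof (cases "neighborhood G g \<inter> S = {}")
      case True
      then have "p \<in> neighborhood (lexicographic_product G H) (g, d) \<inter> S \<times> {a} \<longleftrightarrow> p = (g, a)" for p
        using g assms(3,9)
        by (cases p) (auto simp: mem_neighborhood_lexicographic_product[OF gG assms(7)]
            neighborhood_def[of H])
      moreover have "(g, d) \<in> pverts (lexicographic_product G H) - S \<times> {a}"
        using gG assms(7,8) by simp
      ultimately show ?thesis unfolding u by blast
    next
      case False
      then obtain g' where g': "g' \<in> neighborhood G g" "g' \<in> S" by blast
      then have g'G: "g' \<in> pverts G" using SG by blast
      have "g \<in> neighborhood G g'"
        using g'(1) gG by (auto simp: neighborhood_def dest: G.arcs_symmetric)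
      then have "neighborhood G g' \<inter> S = {g}"
        using at_most_one g g'(2) by blast
      then have "p \<in> neighborhood (lexicographic_product G H) (g', b) \<inter> S \<times> {a} \<longleftrightarrow> p = (g, a)" for p
        using g assms(3,6)
        by (cases p) (auto simp: mem_neighborhood_lexicographic_product[OF g'G assms(4)]
            neighborhood_def[of H])
      moreover have "(g', b) \<in> pverts (lexicographic_product G H) - S \<times> {a}"
        using g'G assms(4,5) by simp
      ultimately show ?thesis unfolding u by blast
    qed
  qed (use G.pair_finite_verts assms(2,3) SG in auto)
  then show ?thesis
    by (simp add: card_cartesian_product S(2))
qed

text \<open>
  Two distinct nonadjacent vertices exist. Either one of them has a neighbour, or it is isolated and
  hence nonadjacent to the end of any edge.
\<close>

lemma not_complete_digraph_obtain_neighbour_and_nonneighbour: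
  assumes "pair_graph H" and "\<not> complete_digraph (card (pverts H)) (with_proj H)"
    and "parcs H \<noteq> {}"
  obtains a b d where "a \<in> pverts H" "b \<in> pverts H" "a \<noteq> b" "(b, a) \<notin> parcs H"
    "d \<in> pverts H" "a \<noteq> d" "(d, a) \<in> parcs H"
proof -
  interpret H: pair_graph H by fact
  have arc: "x \<in> pverts H \<and> y \<in> pverts H \<and> x \<noteq> y" if "(x, y) \<in> parcs H" for x y
    using that H.in_arcsD1 H.in_arcsD2 H.no_loops' by blast
  have "parcs H \<noteq> {(u, v). (u, v) \<in> pverts H \<times> pverts H \<and> u \<noteq> v}"
    using assms(2) H.pair_finite_verts by (simp add: complete_digraph_pair_def)
  then obtain p q where pq: "p \<in> pverts H" "q \<in> pverts H" "p \<noteq> q" "(q, p) \<notin> parcs H"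
    using arc by blast
  obtain d c where dc: "(d, c) \<in> parcs H" using assms(3) by auto
  show thesis
  proof (cases "\<exists>e. (e, p) \<in> parcs H")
    case True
    then show ?thesis using that[of p q] pq arc by blast
  next
    case False
    then have "(p, c) \<notin> parcs H" "c \<noteq> p"
      using dc H.arcs_symmetric by blast+
    then show ?thesis using that[of c p d] pq(1) dc arc by blast
  qed
qed

theorem theorem9:
  fixes G :: "'a pair_pre_digraph" and H :: "'b pair_pre_digraph" and n n' :: nat
  assumes "pair_graph G" and "pverts G \<noteq> {}" and "card (pverts G) = n"
    and "pair_graph H" and "pverts H \<noteq> {}" and "card (pverts H) = n'"
    and "parcs H \<noteq> {}"
  shows "int (super_domination_number (lexicographic_product G H))
           \<le> int (independence_number G) * int (super_domination_number H)
              + (int n - int (independence_number G)) * int n'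
         \<and> (int (super_domination_number H) = int n' - 1
              \<and> \<not> complete_digraph n' (with_proj H)
            \<longrightarrow> int (super_domination_number (lexicographic_product G H))
                  \<le> int n * int n' - int (k_independence_number 2 G))"
proof (intro conjI impI)
  interpret G: pair_graph G by fact
  interpret H: pair_graph H by fact
  show "int (super_domination_number (lexicographic_product G H))
          \<le> int (independence_number G) * int (super_domination_number H)
             + (int n - int (independence_number G)) * int n'"
    using super_domination_number_lexicographic_product_le_independence
      [OF G.pair_finite_verts H.pair_finite_verts] assms(3,6) by simp
  assume "int (super_domination_number H) = int n' - 1
            \<and> \<not> complete_digraph n' (with_proj H)"
  then obtain a b d where "a \<in> pverts H" "b \<in> pverts H" "a \<noteq> b" "(b, a) \<notin> parcs H"
    "d \<in> pverts H" "a \<noteq> d" "(d, a) \<in> parcs H"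
    using not_complete_digraph_obtain_neighbour_and_nonneighbour[OF assms(4)] assms(6,7) by metis
  then show "int (super_domination_number (lexicographic_product G H))
          \<le> int n * int n' - int (k_independence_number 2 G)"
    using super_domination_number_lexicographic_product_le_2_independence
      [OF assms(1) H.pair_finite_verts] assms(3,6) by simp
qed

end
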